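(* Let $k$ and $w$ be integers with $k \geq 3$ and $w \geq k^2$. Then there exists a cyclic resolvable $(wk,k)$-configuration.
   Context: A $(v,k)$-configuration is a pair $(V,\mathcal{B})$, where $V$ is a set of $v$ points and $\mathcal{B}$ is a set of exactly $v$ blocks (subsets of $V$), each containing exactly $k$ points, such that no pair of distinct points occurs in more than one block and every point occurs in exactly $k$ blocks. When $v \equiv 0 \bmod k$, a resolvable $(v,k)$-configuration is a triple $(V,\mathcal{B},\mathcal{R})$ where $(V,\mathcal{B})$ is a $(v,k)$-configuration and $\mathcal{R}$ (the resolution) is a partition of $\mathcal{B}$ into $k$ parallel classes, each parallel class consisting of $v/k$ blocks that partition $V$. A resolvable $(v,k)$-configuration is cyclic if, up to isomorphism, $V=\mathbb{Z}_v$ and $\mathcal{R}$ is invariant under the action $x \mapsto x+1 \pmod v$. *)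

theory Defs
  imports Main "HOL-Library.Disjoint_Sets"
begin

definition configuration :: "nat \<Rightarrow> nat \<Rightarrow> 'a set \<Rightarrow> 'a set set \<Rightarrow> bool" where
  "configuration v k V \<B> \<longleftrightarrow>
     finite V \<and> card V = v \<and> card \<B> = v \<and>
     (\<forall>b\<in>\<B>. b \<subseteq> V \<and> card b = k) \<and>
     (\<forall>x\<in>V. \<forall>y\<in>V. x \<noteq> y \<longrightarrow> card {b \<in> \<B>. x \<in> b \<and> y \<in> b} \<le> 1) \<and>
     (\<forall>x\<in>V. card {b \<in> \<B>. x \<in> b} = k)"

definition parallel_class :: "nat \<Rightarrow> nat \<Rightarrow> 'a set \<Rightarrow> 'a set set \<Rightarrow> bool" where
  "parallel_class v k V P \<longleftrightarrow> card P = v div k \<and> partition_on V P"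

definition resolvable_configuration ::
    "nat \<Rightarrow> nat \<Rightarrow> 'a set \<Rightarrow> 'a set set \<Rightarrow> 'a set set set \<Rightarrow> bool" where
  "resolvable_configuration v k V \<B> \<R> \<longleftrightarrow>
     k dvd v \<and> configuration v k V \<B> \<and>
     partition_on \<B> \<R> \<and> card \<R> = k \<and> (\<forall>P\<in>\<R>. parallel_class v k V P)"

definition resolvable_isomorphism ::
    "('a \<Rightarrow> 'b) \<Rightarrow> 'a set \<Rightarrow> 'a set set \<Rightarrow> 'a set set set \<Rightarrow>
     'b set \<Rightarrow> 'b set set \<Rightarrow> 'b set set set \<Rightarrow> bool" where
  "resolvable_isomorphism f V \<B> \<R> V' \<B>' \<R>' \<longleftrightarrow>
     bij_betw f V V' \<and> (\<lambda>b. f ` b) ` \<B> = \<B>' \<and> (\<lambda>P. (\<lambda>b. f ` b) ` P) ` \<R> = \<R>'"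

text \<open>
  The group of integers modulo \<open>v\<close> is represented by the residues \<open>{0..<int v}\<close>.
\<close>

definition cyclic_shift :: "nat \<Rightarrow> int \<Rightarrow> int" where
  "cyclic_shift v x = (x + 1) mod int v"

text \<open>
  Invariance is as a set of parallel classes: the shift may permute the classes. Since the
  classes cover the block set, the block set is then invariant as well.
\<close>

definition cyclic_resolvable_configuration ::
    "nat \<Rightarrow> nat \<Rightarrow> 'a set \<Rightarrow> 'a set set \<Rightarrow> 'a set set set \<Rightarrow> bool" where
  "cyclic_resolvable_configuration v k V \<B> \<R> \<longleftrightarrow>
     resolvable_configuration v k V \<B> \<R> \<and>
     (\<exists>f \<B>' \<R>'. resolvable_isomorphism f V \<B> \<R> {0..<int v} \<B>' \<R>' \<and>
        (\<lambda>P. (\<lambda>b. cyclic_shift v ` b) ` P) ` \<R>' = \<R>')"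

end

theory Submission
  imports Defs "HOL-Number_Theory.Cong"
begin

text \<open>
  All blocks are translates modulo \<open>w * k\<close> of one base block \<open>S\<close> of \<open>k\<close> integers. Two properties
  of \<open>S\<close> suffice.

  If a sum of two elements of \<open>S\<close> determines them modulo \<open>w * k\<close> up to their order (\<open>S\<close> is a
  Sidon set), then two different translates share at most one point, so the \<open>w * k\<close> translates form a configuration.
  If moreover the elements of \<open>S\<close> represent every residue class modulo \<open>k\<close> exactly once, then
  the translates of \<open>S\<close> by the multiples of \<open>k\<close> tile the cyclic group, and so do the translates by
  any fixed coset of these multiples. The \<open>k\<close> cosets give the \<open>k\<close> parallel classes, and the shift
  by one permutes them cyclically.

  Such an \<open>S\<close> can be chosen greedily, as the elements \<open>i + k * a\<^sub>i\<close> for \<open>0 \<le> i < k\<close> with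
  \<open>a\<^sub>i\<close> taken modulo \<open>w\<close>. In a coincidence of two sums that involves the new element
  \<open>n + k * a\<^sub>n\<close>, reduction modulo \<open>k\<close> determines one of the old elements from the others. This
  is what keeps the number of excluded values quadratic: at most \<open>n\<^sup>2\<close> values are excluded by sums
  containing the new element once, and at most \<open>2 * n\<close> by its double. As
  \<open>n\<^sup>2 + 2 * n < (n + 1)\<^sup>2 \<le> k\<^sup>2 \<le> w\<close>, a value remains at every step.
\<close>

section \<open>A Sidon transversal of the residue classes\<close>

definition sidon_modulo :: "int \<Rightarrow> (int \<Rightarrow> int) \<Rightarrow> int set \<Rightarrow> bool" where
  "sidon_modulo v f I \<longleftrightarrow>
     (\<forall>i\<in>I. \<forall>j\<in>I. \<forall>l\<in>I. \<forall>m\<in>I. [f i + f j = f l + f m] (mod v)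
        \<longrightarrow> (i = l \<and> j = m) \<or> (i = m \<and> j = l))"

lemma cong_of_cong_mult:
  fixes x y :: int
  assumes "[x = y] (mod W * K)"
  shows "[x = y] (mod K)"
  using assms by (metis cong_modulus_mult mult.commute)

lemma quotient_determined:
  fixes K W a c x :: int
  assumes "K > 0" and "[x + K * a = c] (mod W * K)"
  shows "[a = (c - x) div K] (mod W)"
proof -
  obtain t where t: "c - (x + K * a) = W * K * t"
    using assms(2) by (metis cong_iff_dvd_diff cong_sym dvdE)
  then have "c - x = K * (a + W * t)"
    by (simp add: algebra_simps)
  then have "(c - x) div K = a + W * t"
    using assms(1) by simp
  then show ?thesis
    by (simp add: cong_def)
qed

lemma half_modulo_cases:
  fixes W a c :: int
  assumes "0 \<le> a" "a < W" and "[2 * a = c] (mod W)"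
  shows "a = (c mod W) div 2 \<or> a = (c mod W + W) div 2"
proof (cases "2 * a < W")
  case True
  then have "c mod W = 2 * a"
    using assms by (simp add: cong_def)
  then show ?thesis by simp
next
  case False
  have "c mod W = (2 * a - W) mod W"
    using assms(3) by (simp add: cong_def)
  also have "\<dots> = 2 * a - W"
    using False assms(2) by (intro mod_pos_pos_trivial) auto
  finally show ?thesis by simp
qed

text \<open>
  The induction step of the greedy choice. The set \<open>F1\<close> collects the quotients excluded by an
  equation \<open>f n + f i \<equiv> f j + f l\<close>, where \<open>i\<close> is the residue of \<open>j + l - n\<close>; the set \<open>F2\<close>
  collects those excluded by \<open>2 * f n \<equiv> f j + f l\<close>, where \<open>l\<close> is the residue of \<open>2 * n - j\<close>
  and halving modulo \<open>W\<close> has at most two outcomes.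
\<close>

lemma sidon_modulo_extend:
  fixes K W n :: int
  assumes n: "0 \<le> n" "n < K" and W: "(n + 1)\<^sup>2 \<le> W"
    and res: "\<forall>i\<in>{0..<n}. f i mod K = i"
    and sid: "sidon_modulo (W * K) f {0..<n}"
  shows "\<exists>a. sidon_modulo (W * K) (f(n := n + K * a)) {0..<n + 1}"
proof -
  define q1 where
    "q1 = (\<lambda>(j, l). ((f j + f l - f ((j + l - n) mod K) - n) div K) mod W)"
  define c where "c = (\<lambda>j. ((f j + f ((2 * n - j) mod K) - 2 * n) div K) mod W)"
  define q2 where "q2 = (\<lambda>(j, carry). (if carry then c j + W else c j) div 2)"
  define F1 where "F1 = q1 ` ({0..<n} \<times> {0..<n})"
  define F2 where "F2 = q2 ` ({0..<n} \<times> (UNIV :: bool set))"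
  have "card F1 \<le> card ({0..<n} \<times> {0..<n})"
    unfolding F1_def by (intro card_image_le) auto
  moreover have "card F2 \<le> card ({0..<n} \<times> (UNIV :: bool set))"
    unfolding F2_def by (intro card_image_le) auto
  ultimately have "card (F1 \<union> F2) \<le> nat n * nat n + nat n * 2"
    using card_Un_le[of F1 F2] by (simp add: card_cartesian_product)
  also have "\<dots> < nat W"
  proof -
    have "int (nat n * nat n + nat n * 2) = n * n + n * 2"
      using n by simp
    also have "\<dots> < W"
      using W by (simp add: power2_eq_square algebra_simps)
    finally show ?thesis by linarith
  qed
  finally have "card (F1 \<union> F2) < card {0..<W}" by simp
  moreover have "finite (F1 \<union> F2)"
    unfolding F1_def F2_def by simp
  ultimately have "\<not> {0..<W} \<subseteq> F1 \<union> F2"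
    using card_mono[of "F1 \<union> F2" "{0..<W}"] by linarith
  then obtain a where "a \<in> {0..<W}" "a \<notin> F1 \<union> F2" by blast
  then have a: "0 \<le> a" "a < W" "a \<notin> F1" "a \<notin> F2" by simp_all
  have K: "K > 0" using n by simp
  define g where "g = f(n := n + K * a)"
  have gn: "g n = n + K * a" by (simp add: g_def)
  have gf: "g i = f i" if "i \<in> {0..<n}" for i
    using that by (simp add: g_def)
  have gres: "g i mod K = i" if "i \<in> {0..<n + 1}" for i
    using that n res by (cases "i = n") (auto simp: gn gf)
  have sum_res: "[i + j = l + m] (mod K)"
    if eq: "[g i + g j = g l + g m] (mod W * K)"
      and idx: "i \<in> {0..<n + 1}" "j \<in> {0..<n + 1}" "l \<in> {0..<n + 1}" "m \<in> {0..<n + 1}"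
    for i j l m
  proof -
    have "(g i mod K + g j mod K) mod K = (g l mod K + g m mod K) mod K"
      using cong_of_cong_mult[OF eq] by (simp add: cong_def mod_simps)
    then show ?thesis
      using idx by (simp add: gres cong_def)
  qed
  have index_eq: "i = x mod K" if "[i = x] (mod K)" "i \<in> {0..<n}" for i x
    using that n by (auto simp: cong_def)
  have once: False
    if eq: "[g n + g i = g j + g l] (mod W * K)"
      and idx: "i \<in> {0..<n}" "j \<in> {0..<n}" "l \<in> {0..<n}" for i j l
  proof -
    have "[n + i = j + l] (mod K)"
      using sum_res[OF eq] idx n by simp
    then have "[i = j + l - n] (mod K)"
      by (simp add: cong_iff_dvd_diff algebra_simps)
    then have i: "i = (j + l - n) mod K"
      using idx(1) by (rule index_eq)
    have "[n + K * a = f j + f l - f i] (mod W * K)"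
      using eq idx by (simp add: gn gf cong_iff_dvd_diff algebra_simps)
    from quotient_determined[OF K this]
    have "a = q1 (j, l)"
      using a by (simp add: q1_def i cong_def)
    then show False
      using a(3) idx unfolding F1_def by blast
  qed
  have double: False
    if eq: "[g n + g n = g j + g l] (mod W * K)"
      and idx: "j \<in> {0..<n}" "l \<in> {0..<n}" for j l
  proof -
    have "[n + n = j + l] (mod K)"
      using sum_res[OF eq] idx n by simp
    then have "[l = 2 * n - j] (mod K)"
      by (subst cong_sym_eq) (simp add: cong_iff_dvd_diff algebra_simps)
    then have l: "l = (2 * n - j) mod K"
      using idx(2) by (rule index_eq)
    have "[2 * n + K * (2 * a) = f j + f l] (mod W * K)"
      using eq idx by (simp add: gn gf algebra_simps)
    from quotient_determined[OF K this]
    have "a = c j div 2 \<or> a = (c j + W) div 2"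
      using half_modulo_cases[OF a(1,2)] by (simp add: c_def l)
    then have "a = q2 (j, False) \<or> a = q2 (j, True)"
      by (simp add: q2_def)
    then show False
      using a(4) idx unfolding F2_def by blast
  qed
  have cancel: "i = j"
    if eq: "[g i = g j] (mod W * K)" and idx: "i \<in> {0..<n + 1}" "j \<in> {0..<n + 1}" for i j
    using cong_of_cong_mult[OF eq] gres idx by (simp add: cong_def)
  \<comment> \<open>It remains to sort a coincidence by the positions at which the index \<open>n\<close> occurs.\<close>
  have "(i = l \<and> j = m) \<or> (i = m \<and> j = l)"
    if eq: "[g i + g j = g l + g m] (mod W * K)"
      and idx: "i \<in> {0..<n + 1}" "j \<in> {0..<n + 1}" "l \<in> {0..<n + 1}" "m \<in> {0..<n + 1}"
    for i j l m
  proof -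
    have old: "x = n \<or> x \<in> {0..<n}" if "x \<in> {0..<n + 1}" for x
      using that by auto
    consider "i = l" | "i = m" | "j = l" | "j = m"
      | "i \<noteq> l" "i \<noteq> m" "j \<noteq> l" "j \<noteq> m" by blast
    then show ?thesis
    proof cases
      case 1
      then have "[g j = g m] (mod W * K)" using eq by (simp add: cong_add_lcancel)
      then show ?thesis using 1 cancel idx by blast
    next
      case 2
      then have "[g j = g l] (mod W * K)"
        using eq by (metis add.commute cong_add_lcancel)
      then show ?thesis using 2 cancel idx by blast
    next
      case 3
      then have "[g i = g m] (mod W * K)"
        using eq by (metis add.commute cong_add_lcancel)
      then show ?thesis using 3 cancel idx by blast
    next
      case 4
      then have "[g i = g l] (mod W * K)" using eq by (simp add: cong_add_rcancel)
      then show ?thesis using 4 cancel idx by blast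
    next
      case 5
      note distinct = 5
      consider "i = n" "j = n" | "i = n" "j \<in> {0..<n}" | "j = n" "i \<in> {0..<n}"
        | "l = n" "m = n" | "l = n" "m \<in> {0..<n}" | "m = n" "l \<in> {0..<n}"
        | "i \<in> {0..<n}" "j \<in> {0..<n}" "l \<in> {0..<n}" "m \<in> {0..<n}"
        using idx[THEN old] by blast
      then show ?thesis
      proof cases
        case 1 then show ?thesis using double[of l m] eq distinct idx[THEN old] by blast
      next
        case 2 then show ?thesis using once[of j l m] eq distinct idx[THEN old] by blast
      next
        case 3 then show ?thesis
          using once[of i l m] eq distinct idx[THEN old] by (metis add.commute)
      next
        case 4 then show ?thesis
          using double[of i j] cong_sym[OF eq] distinct idx[THEN old] by blast
      next
        case 5 then show ?thesis
          using once[of m i j] cong_sym[OF eq] distinct idx[THEN old] by blast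
      next
        case 6 then show ?thesis
          using once[of l i j] cong_sym[OF eq] distinct idx[THEN old] by (metis add.commute)
      next
        case 7
        then have "[f i + f j = f l + f m] (mod W * K)"
          using eq by (simp only: gf)
        with 7 sid show ?thesis
          unfolding sidon_modulo_def by blast
      qed
    qed
  qed
  then have "sidon_modulo (W * K) g {0..<n + 1}"
    unfolding sidon_modulo_def by blast
  then show ?thesis
    unfolding g_def by blast
qed

lemma sidon_transversal_exists:
  fixes K W :: int
  assumes "K\<^sup>2 \<le> W" and "int n \<le> K"
  shows "\<exists>f. (\<forall>i\<in>{0..<int n}. f i mod K = i) \<and> sidon_modulo (W * K) f {0..<int n}"
  using assms(2)
proof (induction n)
  case 0
  then show ?case by (simp add: sidon_modulo_def)
next
  case (Suc n)
  then obtain f where f: "\<forall>i\<in>{0..<int n}. f i mod K = i"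
      "sidon_modulo (W * K) f {0..<int n}"
    by auto
  have "(int n + 1)\<^sup>2 \<le> K\<^sup>2"
    using Suc.prems by (intro power_mono) auto
  then have W: "(int n + 1)\<^sup>2 \<le> W"
    using assms(1) by simp
  obtain a where a: "sidon_modulo (W * K) (f(int n := int n + K * a)) {0..<int n + 1}"
    using sidon_modulo_extend[OF _ _ W f] Suc.prems by auto
  let ?g = "f(int n := int n + K * a)"
  have "\<forall>i\<in>{0..<int (Suc n)}. ?g i mod K = i"
    using f(1) Suc.prems by auto
  moreover have "sidon_modulo (W * K) ?g {0..<int (Suc n)}"
    using a by (simp add: add.commute)
  ultimately show ?case by blast
qed

section \<open>The configuration of translates\<close>

locale sidon_transversal =
  fixes K W :: int and f :: "int \<Rightarrow> int"
  assumes K: "K \<ge> 2" and W: "W > 0"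
    and res: "i \<in> {0..<K} \<Longrightarrow> f i mod K = i"
    and sidon: "sidon_modulo (W * K) f {0..<K}"
begin

definition points :: "int set" where
  "points = {0..<W * K}"

definition translate :: "int \<Rightarrow> int set" where
  "translate t = (\<lambda>i. (f i + t) mod (W * K)) ` {0..<K}"

definition blocks :: "int set set" where
  "blocks = translate ` points"

definition coset_class :: "int \<Rightarrow> int set set" where
  "coset_class c = translate ` {t \<in> points. t mod K = c}"

definition resolution :: "int set set set" where
  "resolution = coset_class ` {0..<K}"

lemma modulus_pos: "W * K > 0"
  using K W by simp

lemma mod_in_points [simp]: "x mod (W * K) \<in> points"
  using modulus_pos by (simp add: points_def)

lemma mod_points [simp]: "t \<in> points \<Longrightarrow> t mod (W * K) = t"
  by (simp add: points_def)

lemma cong_points_eq: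
  "\<lbrakk>[s = t] (mod W * K); s \<in> points; t \<in> points\<rbrakk> \<Longrightarrow> s = t"
  by (metis cong_def mod_points)

lemma index_eqI:
  assumes "[f i = f j] (mod K)" "i \<in> {0..<K}" "j \<in> {0..<K}"
  shows "i = j"
  using assms res by (metis cong_def)

lemma mem_translate_iff:
  assumes "x \<in> points"
  shows "x \<in> translate t \<longleftrightarrow> (\<exists>i\<in>{0..<K}. [x = f i + t] (mod W * K))"
  using assms by (auto simp: translate_def cong_def image_iff)

lemma translate_subset: "translate t \<subseteq> points"
  by (auto simp: translate_def)

lemma card_translate: "card (translate t) = nat K"
proof -
  have "inj_on (\<lambda>i. (f i + t) mod (W * K)) {0..<K}"
  proof (rule inj_onI)
    fix i j assume ij: "i \<in> {0..<K}" "j \<in> {0..<K}"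
      and "(f i + t) mod (W * K) = (f j + t) mod (W * K)"
    then have "[f i + t = f j + t] (mod W * K)"
      by (simp add: cong_def)
    then have "[f i = f j] (mod K)"
      using cong_of_cong_mult cong_add_rcancel by blast
    then show "i = j"
      using ij by (rule index_eqI)
  qed
  then show ?thesis
    by (simp add: translate_def card_image)
qed

text \<open>
  If \<open>x \<equiv> f i + s \<equiv> f l + t\<close> and \<open>y \<equiv> f j + s \<equiv> f m + t\<close>, then
  \<open>f i + f m \<equiv> f j + f l\<close>, and the Sidon property leaves only \<open>x = y\<close> or \<open>s = t\<close>.
\<close>

lemma translate_eqI:
  assumes st: "s \<in> points" "t \<in> points" and "x \<noteq> y"
    and s: "x \<in> translate s" "y \<in> translate s"
    and t: "x \<in> translate t" "y \<in> translate t"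
  shows "s = t"
proof -
  have xy: "x \<in> points" "y \<in> points"
    using s translate_subset by auto
  obtain i j where ij: "i \<in> {0..<K}" "j \<in> {0..<K}"
      "[x = f i + s] (mod W * K)" "[y = f j + s] (mod W * K)"
    using s xy by (auto simp: mem_translate_iff)
  obtain l m where lm: "l \<in> {0..<K}" "m \<in> {0..<K}"
      "[x = f l + t] (mod W * K)" "[y = f m + t] (mod W * K)"
    using t xy by (auto simp: mem_translate_iff)
  have il: "[f i + s = f l + t] (mod W * K)"
    using ij(3) lm(3) by (metis cong_sym cong_trans)
  have jm: "[f m + t = f j + s] (mod W * K)"
    using ij(4) lm(4) by (metis cong_sym cong_trans)
  have "[(f i + s) + (f m + t) = (f l + t) + (f j + s)] (mod W * K)"
    using il jm by (rule cong_add)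
  then have "[f i + f m = f j + f l] (mod W * K)"
    by (simp add: cong_iff_dvd_diff algebra_simps)
  then have "i = j \<or> i = l"
    using sidon ij(1,2) lm(1,2) unfolding sidon_modulo_def by blast
  moreover have "i \<noteq> j"
    using ij(3,4) xy \<open>x \<noteq> y\<close> by (metis cong_points_eq cong_sym cong_trans)
  ultimately have "[s = t] (mod W * K)"
    using il by (simp add: cong_add_lcancel)
  then show ?thesis
    using st by (rule cong_points_eq)
qed

lemma inj_on_translate: "inj_on translate points"
proof (rule inj_onI)
  fix s t assume st: "s \<in> points" "t \<in> points" "translate s = translate t"
  have "\<not> card (translate s) \<le> 1"
    using K by (simp add: card_translate)
  then obtain x y where "x \<in> translate s" "y \<in> translate s" "x \<noteq> y"
    by (metis card_le_Suc0_iff_eq One_nat_def card.infinite zero_le_one)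
  then show "s = t"
    using st translate_eqI by metis
qed

lemma card_blocks_through_pair:
  assumes "x \<noteq> y"
  shows "card {b \<in> blocks. x \<in> b \<and> y \<in> b} \<le> 1"
proof -
  have "finite {b \<in> blocks. x \<in> b \<and> y \<in> b}"
    by (simp add: blocks_def points_def)
  moreover have "b = b'" if "b \<in> {b \<in> blocks. x \<in> b \<and> y \<in> b}"
      "b' \<in> {b \<in> blocks. x \<in> b \<and> y \<in> b}" for b b'
    using that assms unfolding blocks_def by (auto dest: translate_eqI)
  ultimately show ?thesis
    by (simp add: card_le_Suc0_iff_eq)
qed

lemma card_blocks_through_point:
  assumes x: "x \<in> points"
  shows "card {b \<in> blocks. x \<in> b} = nat K"
proof -
  let ?t = "\<lambda>i. (x - f i) mod (W * K)"
  have mem: "x \<in> translate t \<longleftrightarrow> t \<in> ?t ` {0..<K}" if "t \<in> points" for t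
  proof -
    have "[x = f i + t] (mod W * K) \<longleftrightarrow> t = ?t i" for i
    proof -
      have "[x = f i + t] (mod W * K) \<longleftrightarrow> [x - f i = t] (mod W * K)"
        by (simp add: cong_iff_dvd_diff algebra_simps)
      then show ?thesis
        using that by (auto simp: cong_def)
    qed
    then show ?thesis
      using x by (auto simp: mem_translate_iff)
  qed
  have "{b \<in> blocks. x \<in> b} = translate ` ?t ` {0..<K}"
    using mem by (auto simp: blocks_def)
  moreover have "inj_on translate (?t ` {0..<K})"
    using inj_on_translate by (rule inj_on_subset) auto
  moreover have "inj_on ?t {0..<K}"
  proof (rule inj_onI)
    fix i j assume ij: "i \<in> {0..<K}" "j \<in> {0..<K}" and "?t i = ?t j"
    then have "[x - f i = x - f j] (mod W * K)"
      by (simp add: cong_def)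
    then have "[f j = f i] (mod W * K)"
      by (simp add: cong_iff_dvd_diff)
    then show "i = j"
      using ij cong_of_cong_mult index_eqI by blast
  qed
  ultimately show ?thesis
    by (simp add: card_image)
qed

lemma configuration_translates:
  "configuration (nat (W * K)) (nat K) points blocks"
proof -
  have "card blocks = nat (W * K)"
    using inj_on_translate by (simp add: blocks_def card_image points_def)
  then show ?thesis
    using card_translate translate_subset card_blocks_through_pair card_blocks_through_point
    unfolding configuration_def by (auto simp: blocks_def points_def)
qed

section \<open>The parallel classes\<close>

lemma card_coset:
  assumes "c \<in> {0..<K}"
  shows "card {t \<in> points. t mod K = c} = nat W"
proof -
  have "{t \<in> points. t mod K = c} = (\<lambda>q. c + K * q) ` {0..<W}"
  proof (intro subset_antisym subsetI)
    fix t assume t: "t \<in> {t \<in> points. t mod K = c}"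
    then have "t = c + K * (t div K)" by auto
    moreover have "t div K \<in> {0..<W}"
    proof -
      have "K * (t div K) \<le> t"
        using K by (simp add: minus_mod_eq_mult_div [symmetric])
      also have "t < K * W"
        using t by (simp add: points_def mult.commute)
      finally have "t div K < W"
        using K by simp
      then show ?thesis
        using t K by (simp add: points_def pos_imp_zdiv_nonneg_iff)
    qed
    ultimately show "t \<in> (\<lambda>q. c + K * q) ` {0..<W}" by blast
  next
    fix t assume "t \<in> (\<lambda>q. c + K * q) ` {0..<W}"
    then obtain q where q: "0 \<le> q" "q \<le> W - 1" "t = c + K * q" by auto
    have "K * q \<le> K * (W - 1)"
      using q K by (intro mult_left_mono) auto
    then have "t < W * K"
      using q assms by (simp add: algebra_simps)
    then show "t \<in> {t \<in> points. t mod K = c}"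
      using q assms K by (simp add: points_def)
  qed
  moreover have "inj_on (\<lambda>q. c + K * q) {0..<W}"
    using K by (auto simp: inj_on_def)
  ultimately show ?thesis
    by (simp add: card_image)
qed

text \<open>
  A block of the class \<open>c\<close> that contains \<open>x \<equiv> f i + t\<close> has \<open>i \<equiv> x - c\<close> modulo \<open>K\<close>. This
  fixes \<open>i\<close> because the base block is a transversal, and then it fixes \<open>t\<close>.
\<close>

lemma parallel_class_coset_class:
  assumes c: "c \<in> {0..<K}"
  shows "parallel_class (nat (W * K)) (nat K) points (coset_class c)"
proof -
  have "inj_on translate {t \<in> points. t mod K = c}"
    using inj_on_translate by (rule inj_on_subset) auto
  then have "card (coset_class c) = nat W"
    using card_coset[OF c] by (simp add: coset_class_def card_image)
  moreover have "nat (W * K) div nat K = nat W"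
    using K W by (simp add: nat_mult_distrib)
  moreover have "partition_on points (coset_class c)"
  proof (rule partition_onI)
    show "{} \<notin> coset_class c"
      using K by (auto simp: coset_class_def translate_def)
  next
    show "\<Union> (coset_class c) = points"
    proof (intro subset_antisym subsetI)
      fix x assume "x \<in> \<Union> (coset_class c)"
      then show "x \<in> points"
        using translate_subset by (auto simp: coset_class_def)
    next
      fix x assume x: "x \<in> points"
      define i where "i = (x - c) mod K"
      define t where "t = (x - f i) mod (W * K)"
      have i: "i \<in> {0..<K}"
        using K by (simp add: i_def)
      have "t mod K = (x - f i mod K) mod K"
        by (simp add: t_def mod_mod_cancel mod_simps)
      also have "\<dots> = c mod K"
        using res[OF i] by (simp add: i_def mod_simps)
      also have "\<dots> = c"
        using c by simp
      finally have "t mod K = c" .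
      moreover have "t \<in> points"
        by (simp add: t_def)
      moreover have "[x = f i + t] (mod W * K)"
        by (simp add: t_def cong_def mod_simps)
      then have "x \<in> translate t"
        using x i by (auto simp: mem_translate_iff)
      ultimately show "x \<in> \<Union> (coset_class c)"
        by (auto simp: coset_class_def)
    qed
  next
    fix b b' assume "b \<in> coset_class c" "b' \<in> coset_class c" "b \<noteq> b'"
    then obtain s t where st: "s \<in> points" "t \<in> points" "s mod K = c" "t mod K = c"
        "b = translate s" "b' = translate t" "s \<noteq> t"
      by (auto simp: coset_class_def)
    have False if xb: "x \<in> b" "x \<in> b'" for x
    proof -
      have x: "x \<in> points"
        using xb st translate_subset by auto
      obtain i j where ij: "i \<in> {0..<K}" "j \<in> {0..<K}"
          "[x = f i + s] (mod W * K)" "[x = f j + t] (mod W * K)"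
        using xb st x by (auto simp: mem_translate_iff)
      have eq: "[f i + s = f j + t] (mod W * K)"
        using ij(3,4) by (metis cong_sym cong_trans)
      have "[s = t] (mod K)"
        using st by (simp add: cong_def)
      then have "[f i = f j] (mod K)"
        using cong_diff[OF cong_of_cong_mult[OF eq]] by fastforce
      then have "i = j"
        using ij(1,2) by (rule index_eqI)
      then have "[s = t] (mod W * K)"
        using eq by (simp add: cong_add_lcancel)
      then show False
        using st cong_points_eq by blast
    qed
    then show "disjnt b b'"
      by (auto simp: disjnt_def)
  qed
  ultimately show ?thesis
    unfolding parallel_class_def by simp
qed

lemma coset_class_nonempty:
  assumes "c \<in> {0..<K}"
  shows "coset_class c \<noteq> {}"
proof -
  have "card {t \<in> points. t mod K = c} \<noteq> 0"
    using card_coset[OF assms] W by simp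
  then show ?thesis
    unfolding coset_class_def by (metis card.empty image_is_empty)
qed

lemma coset_class_disjoint:
  assumes "c \<noteq> d"
  shows "coset_class c \<inter> coset_class d = {}"
  using assms inj_on_translate by (auto simp: coset_class_def inj_on_def)

lemma partition_on_resolution: "partition_on blocks resolution"
proof (rule partition_onI)
  show "\<Union> resolution = blocks"
  proof (intro subset_antisym subsetI)
    fix b assume "b \<in> blocks"
    then obtain t where "t \<in> points" "b = translate t"
      by (auto simp: blocks_def)
    then have "b \<in> coset_class (t mod K)"
      by (auto simp: coset_class_def)
    moreover have "t mod K \<in> {0..<K}"
      using K by simp
    ultimately show "b \<in> \<Union> resolution"
      by (auto simp: resolution_def)
  qed (auto simp: resolution_def coset_class_def blocks_def)
next
  fix P Q assume "P \<in> resolution" "Q \<in> resolution" "P \<noteq> Q"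
  then show "disjnt P Q"
    using coset_class_disjoint unfolding resolution_def disjnt_def by (metis imageE)
qed (use coset_class_nonempty in \<open>force simp: resolution_def\<close>)

lemma card_resolution: "card resolution = nat K"
proof -
  have "inj_on coset_class {0..<K}"
    using coset_class_nonempty coset_class_disjoint by (metis inj_onI inf.idem)
  then show ?thesis
    by (simp add: resolution_def card_image)
qed

section \<open>Invariance under the shift\<close>

lemma cyclic_shift_translate:
  "cyclic_shift (nat (W * K)) ` translate t = translate ((t + 1) mod (W * K))"
  using modulus_pos
  by (simp add: translate_def cyclic_shift_def image_image mod_simps algebra_simps)

lemma shift_coset:
  assumes "c \<in> {0..<K}"
  shows "(\<lambda>t. (t + 1) mod (W * K)) ` {t \<in> points. t mod K = c}
       = {t \<in> points. t mod K = (c + 1) mod K}"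
proof (intro subset_antisym subsetI)
  fix s assume "s \<in> (\<lambda>t. (t + 1) mod (W * K)) ` {t \<in> points. t mod K = c}"
  then show "s \<in> {t \<in> points. t mod K = (c + 1) mod K}"
    by (auto simp: mod_mod_cancel mod_simps)
next
  fix s assume s: "s \<in> {t \<in> points. t mod K = (c + 1) mod K}"
  define t where "t = (s - 1) mod (W * K)"
  have "t mod K = (s mod K - 1) mod K"
    by (simp add: t_def mod_mod_cancel mod_simps)
  also have "\<dots> = c"
    using s assms by (simp add: mod_simps)
  finally have "t mod K = c" .
  moreover have "s = (t + 1) mod (W * K)"
    using s by (simp add: t_def mod_simps)
  moreover have "t \<in> points"
    by (simp add: t_def)
  ultimately show "s \<in> (\<lambda>t. (t + 1) mod (W * K)) ` {t \<in> points. t mod K = c}"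
    by blast
qed

lemma cyclic_shift_coset_class:
  assumes "c \<in> {0..<K}"
  shows "(\<lambda>b. cyclic_shift (nat (W * K)) ` b) ` coset_class c = coset_class ((c + 1) mod K)"
  unfolding coset_class_def shift_coset[OF assms, symmetric]
  by (simp add: image_image cyclic_shift_translate)

lemma successor_modulo_image: "(\<lambda>c. (c + 1) mod K) ` {0..<K} = {0..<K}"
proof (intro subset_antisym subsetI)
  fix c assume c: "c \<in> {0..<K}"
  have "c = ((c - 1) mod K + 1) mod K"
    using c by (simp add: mod_simps)
  moreover have "(c - 1) mod K \<in> {0..<K}"
    using K by simp
  ultimately show "c \<in> (\<lambda>c. (c + 1) mod K) ` {0..<K}" by blast
qed (use K in auto)

lemma cyclic_shift_resolution:
  "(\<lambda>P. (\<lambda>b. cyclic_shift (nat (W * K)) ` b) ` P) ` resolution = resolution"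
proof -
  have "(\<lambda>P. (\<lambda>b. cyclic_shift (nat (W * K)) ` b) ` P) ` resolution
      = coset_class ` (\<lambda>c. (c + 1) mod K) ` {0..<K}"
    unfolding resolution_def image_image
    by (intro image_cong refl cyclic_shift_coset_class)
  then show ?thesis
    by (simp only: successor_modulo_image resolution_def)
qed

theorem cyclic_resolvable_translates:
  "cyclic_resolvable_configuration (nat (W * K)) (nat K) points blocks resolution"
proof -
  have "nat K dvd nat (W * K)"
    using W by (simp add: nat_mult_distrib)
  moreover have "\<forall>P\<in>resolution. parallel_class (nat (W * K)) (nat K) points P"
    using parallel_class_coset_class by (auto simp: resolution_def)
  ultimately have "resolvable_configuration (nat (W * K)) (nat K) points blocks resolution"
    using configuration_translates partition_on_resolution card_resolution
    by (simp add: resolvable_configuration_def)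
  moreover have "resolvable_isomorphism id points blocks resolution
      {0..<int (nat (W * K))} blocks resolution"
    using modulus_pos by (simp add: resolvable_isomorphism_def points_def)
  ultimately show ?thesis
    using cyclic_shift_resolution unfolding cyclic_resolvable_configuration_def by blast
qed

end

section \<open>Cyclic resolvable configurations from the greedy transversal\<close>

theorem theorem4p6:
  fixes k w :: nat
  assumes "k \<ge> 3" and "w \<ge> k ^ 2"
  shows "\<exists>(V :: int set) \<B> \<R>. cyclic_resolvable_configuration (w * k) k V \<B> \<R>"
proof -
  have "(int k)\<^sup>2 \<le> int w"
    using assms(2) by (metis of_nat_le_iff of_nat_power)
  then obtain f where f: "\<forall>i\<in>{0..<int k}. f i mod int k = i"
      "sidon_modulo (int w * int k) f {0..<int k}"
    using sidon_transversal_exists[of "int k" "int w" k] by auto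
  have "w > 0"
    using assms by (metis gr0I le_zero_eq not_numeral_le_zero power_eq_0_iff)
  then interpret sidon_transversal "int k" "int w" f
    using assms(1) f by unfold_locales auto
  have "nat (int w * int k) = w * k"
    by (simp flip: of_nat_mult)
  then show ?thesis
    using cyclic_resolvable_translates by (metis nat_int)
qed

end
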